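(* Let $g:[0,1]\to\mathbb{R}^2$ be a simple open rectifiable plane arc with positive thickness. Then there is exactly one unordered pair $\{l,l'\}$ of parallel support lines of $g$ (with $g$ lying in the closed strip between $l$ and $l'$) for which there exist parameters $r<s<t$ in $[0,1]$ such that $g(s)$ lies on one of the two lines and both $g(r)$ and $g(t)$ lie on the other.
   Context: A rectifiable plane arc is a continuous map $g:[0,1]\to\mathbb{R}^2$ of finite length. It is open if $g(0)\neq g(1)$, and simple if $g$ is injective. A support line of $g$ is a line that contains at least one point of $g([0,1])$ and has $g([0,1])$ contained in one of its two closed half-planes. The thickness of $g$ is the minimum, over all directions, of the distance between the two parallel support lines of $g$ in that direction that bound the strip containing $g$. *)

theory Defs
  imports "HOL-Analysis.Analysis"
begin

definition polygonal_length :: "(real \<Rightarrow> 'a::metric_space) \<Rightarrow> real list \<Rightarrow> real" where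
  "polygonal_length g ts = (\<Sum>i<length ts - 1. dist (g (ts ! i)) (g (ts ! Suc i)))"

text \<open>The length of a path is the supremum of the lengths of its inscribed polygons.\<close>

definition rectifiable :: "(real \<Rightarrow> 'a::metric_space) \<Rightarrow> bool" where
  "rectifiable g \<longleftrightarrow> path g \<and>
     bdd_above {polygonal_length g ts | ts. sorted ts \<and> set ts \<subseteq> {0..1}}"

text \<open>Lines of the plane are given by normal equations \<open>a \<bullet> x = b\<close> with \<open>a \<noteq> 0\<close>. Replacing
  \<open>(a, b)\<close> by \<open>(-a, -b)\<close> exchanges the two closed half-planes, so a single inequality covers
  both of them.\<close>

definition support_line :: "(real \<Rightarrow> real^2) \<Rightarrow> (real^2) set \<Rightarrow> bool" where
  "support_line g l \<longleftrightarrow> l \<inter> path_image g \<noteq> {} \<and>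
     (\<exists>a b. a \<noteq> 0 \<and> l = {x. a \<bullet> x = b} \<and> path_image g \<subseteq> {x. a \<bullet> x \<le> b})"

text \<open>Two support lines with a common normal vector \<open>a\<close> (that is, parallel ones) such that \<open>g\<close>
  lies in the closed strip between them. The relation is symmetric in the two lines, and it can
  hold for \<open>l = l'\<close> only if \<open>g\<close> lies on a line.\<close>

definition parallel_support_lines :: "(real \<Rightarrow> real^2) \<Rightarrow> (real^2) set \<Rightarrow> (real^2) set \<Rightarrow> bool" where
  "parallel_support_lines g l l' \<longleftrightarrow> support_line g l \<and> support_line g l' \<and>
     (\<exists>a b c. a \<noteq> 0 \<and> l = {x. a \<bullet> x = b} \<and> l' = {x. a \<bullet> x = c} \<and>
        path_image g \<subseteq> {x. b \<le> a \<bullet> x \<and> a \<bullet> x \<le> c})"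

text \<open>Each direction contributes exactly one pair of lines. The infimum is a minimum because the
  width of a compact set depends continuously on the direction.\<close>

definition thickness :: "(real \<Rightarrow> real^2) \<Rightarrow> real" where
  "thickness g = Inf {setdist l l' | l l'. parallel_support_lines g l l'}"

end

theory Submission
  imports Defs
begin

text \<open>
  For existence, suppose that no direction alternates. Then for every unit vector \<open>u\<close> the
  parameters at which \<open>u \<bullet> g\<close> is maximal either all precede or all follow those at which it is
  minimal. Both conditions on \<open>u\<close> are closed, and they are exchanged by \<open>u \<mapsto> -u\<close>, which
  contradicts the connectedness of the circle.

  For uniqueness, let two linearly independent normals \<open>u\<close>, \<open>v\<close> alternate at \<open>r < s < t\<close> and
  \<open>p < q < w\<close>. In the coordinates \<open>(u \<bullet> x, v \<bullet> x)\<close> the arc lies in a rectangle, and arcs joining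
  opposite sides must meet. As the arc is simple, comparing \<open>[r,s]\<close> with \<open>[q,w]\<close> and \<open>[s,t]\<close> with
  \<open>[p,q]\<close> forces \<open>s = q\<close>, so \<open>g s\<close> is a corner. Before \<open>s\<close> and after \<open>s\<close> the arc visits both sides
  that avoid this corner; the one of the two parts that reaches one of these sides closer to the
  opposite corner cannot get to \<open>g s\<close> without crossing the other part.
\<close>

section \<open>Crossing paths in a rectangle\<close>

text \<open>A detour below the rectangle reduces this to \<open>fashoda\<close>: \<open>g\<close> is
  prolonged down from its end and then to the right side, \<open>f\<close> is prolonged straight
  down from its start. As \<open>g\<close> ends to the right of the start of \<open>f\<close>, the
  two extensions do not meet.\<close>

lemma fashoda_corner:
  fixes f g :: "real \<Rightarrow> real^2"
  assumes "path f" "path g"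
    and paf: "path_image f \<subseteq> cbox a b" and pag: "path_image g \<subseteq> cbox a b"
    and f0: "pathstart f $ 2 = a $ 2" and f1: "pathfinish f $ 2 = b $ 2"
    and g0: "pathstart g $ 1 = a $ 1" and g1: "pathfinish g $ 2 = a $ 2"
    and less: "pathstart f $ 1 < pathfinish g $ 1"
  obtains z where "z \<in> path_image f" "z \<in> path_image g"
proof -
  define x z where "x = pathstart f" and "z = pathfinish g"
  \<comment> \<open>Depth 2 is the bottom of the enlarged rectangle \<open>cbox a' b\<close>, where
    the extended \<open>f\<close> has to start; the extended \<open>g\<close> reaches the right side
    at depth 1.\<close>
  define x' where "x' = (vector [x $ 1, a $ 2 - 2] :: real^2)"
  define z' where "z' = (vector [z $ 1, a $ 2 - 1] :: real^2)"
  define z'' where "z'' = (vector [b $ 1, a $ 2 - 1] :: real^2)"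
  define a' where "a' = (vector [a $ 1, a $ 2 - 2] :: real^2)"
  have comps [simp]: "x' $ 1 = x $ 1" "x' $ 2 = a $ 2 - 2" "z' $ 1 = z $ 1" "z' $ 2 = a $ 2 - 1"
    "z'' $ 1 = b $ 1" "z'' $ 2 = a $ 2 - 1" "a' $ 1 = a $ 1" "a' $ 2 = a $ 2 - 2"
    by (simp_all add: x'_def z'_def z''_def a'_def)
  have xin: "x \<in> path_image f" and zin: "z \<in> path_image g"
    by (auto simp: x_def z_def)
  have box: "y \<in> cbox c d \<longleftrightarrow> c $ 1 \<le> y $ 1 \<and> y $ 1 \<le> d $ 1 \<and> c $ 2 \<le> y $ 2 \<and> y $ 2 \<le> d $ 2"
    for y c d :: "real^2"
    by (auto simp: mem_box_cart forall_2)
  have xb: "a $ 1 \<le> x $ 1" "x $ 1 \<le> b $ 1" "x $ 2 = a $ 2" "a $ 2 \<le> b $ 2"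
    and zb: "a $ 1 \<le> z $ 1" "z $ 1 \<le> b $ 1" "z $ 2 = a $ 2" and xz: "x $ 1 < z $ 1"
    using subsetD[OF paf xin] subsetD[OF pag zin] f0 g1 less unfolding box x_def z_def by auto
  have sub: "cbox a b \<subseteq> cbox a' b"
    by (auto simp: box)
  have xseg: "y \<in> closed_segment x' x \<longleftrightarrow> y $ 1 = x $ 1 \<and> a $ 2 - 2 \<le> y $ 2 \<and> y $ 2 \<le> a $ 2" for y
    using segment_vertical[of x' x y] xb by auto
  have zseg: "y \<in> closed_segment z z' \<longleftrightarrow> y $ 1 = z $ 1 \<and> a $ 2 - 1 \<le> y $ 2 \<and> y $ 2 \<le> a $ 2" for y
    using segment_vertical[of z z' y] zb by auto
  have zseg': "y \<in> closed_segment z' z'' \<longleftrightarrow> y $ 2 = a $ 2 - 1 \<and> z $ 1 \<le> y $ 1 \<and> y $ 1 \<le> b $ 1" for y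
    using segment_horizontal[of z' z'' y] zb by auto
  let ?P1 = "g +++ linepath z z' +++ linepath z' z''"
  let ?P2 = "linepath x' x +++ f"
  have im1: "path_image ?P1 = path_image g \<union> (closed_segment z z' \<union> closed_segment z' z'')"
    by (simp add: path_image_join z_def)
  have im2: "path_image ?P2 = closed_segment x' x \<union> path_image f"
    by (simp add: path_image_join x_def)
  have "path ?P1" "path ?P2"
    using assms(1,2) by (auto simp: x_def z_def intro!: path_join_imp)
  moreover have "path_image ?P1 \<subseteq> cbox a' b"
    unfolding im1 using pag sub xb zb by (auto simp: zseg zseg' box)
  moreover have "path_image ?P2 \<subseteq> cbox a' b"
    unfolding im2 using paf sub xb by (auto simp: xseg box)
  ultimately obtain y where "y \<in> path_image ?P1" "y \<in> path_image ?P2"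
    using g0 f1 by (rule_tac fashoda[of ?P1 ?P2 a' b]) auto
  then have y1: "y \<in> path_image g \<or> y \<in> closed_segment z z' \<or> y \<in> closed_segment z' z''"
    and y2: "y \<in> closed_segment x' x \<or> y \<in> path_image f"
    unfolding im1 im2 by auto
  \<comment> \<open>The extensions touch the original rectangle only at \<open>x\<close> and
    \<open>z\<close>, which already belong to the original paths.\<close>
  have low: "a $ 2 \<le> y $ 2" if "y \<in> path_image f \<or> y \<in> path_image g"
    using that paf pag by (auto simp: box)
  have "y \<in> path_image f \<and> y \<in> path_image g"
  proof (cases "y \<in> path_image f")
    case True
    then have "y \<in> path_image g \<or> y = z"
      using y1 low zb by (auto simp: zseg zseg' vec_eq_iff forall_2)
    then show ?thesis
      using True zin by auto
  next
    case False
    then have seg: "y \<in> closed_segment x' x"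
      using y2 by simp
    then have "y \<in> path_image g"
      using y1 xz by (auto simp: xseg zseg zseg')
    then have "y = x"
      using seg low xb by (auto simp: xseg vec_eq_iff forall_2)
    then show ?thesis
      using False xin by simp
  qed
  then show thesis
    using that by blast
qed

section \<open>Coordinates given by two normals\<close>

text \<open>Cramer's rule. It keeps the arc simple when \<open>u \<bullet> x\<close> and
  \<open>v \<bullet> x\<close> serve as coordinates.\<close>

lemma inner_pair_inj:
  fixes u v x y :: "real^2"
  assumes "u $ 1 * v $ 2 \<noteq> u $ 2 * v $ 1" and "u \<bullet> x = u \<bullet> y" and "v \<bullet> x = v \<bullet> y"
  shows "x = y"
proof -
  have 1: "u $ 1 * (x $ 1 - y $ 1) + u $ 2 * (x $ 2 - y $ 2) = 0"
    and 2: "v $ 1 * (x $ 1 - y $ 1) + v $ 2 * (x $ 2 - y $ 2) = 0"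
    using assms(2,3) by (simp_all add: inner_vec_def sum_2 algebra_simps)
  have "(u $ 1 * v $ 2 - u $ 2 * v $ 1) * (x $ 1 - y $ 1) = 0"
    using 1 2 by algebra
  moreover have "(u $ 1 * v $ 2 - u $ 2 * v $ 1) * (x $ 2 - y $ 2) = 0"
    using 1 2 by algebra
  ultimately show ?thesis
    using assms(1) by (simp add: vec_eq_iff forall_2)
qed

lemma parallel_vec2:
  fixes u v :: "real^2"
  assumes "u $ 1 * v $ 2 = u $ 2 * v $ 1" "u \<noteq> 0"
  obtains k where "v = k *\<^sub>R u"
proof (cases "u $ 1 = 0")
  case True
  then have "u $ 2 \<noteq> 0"
    using assms(2) by (auto simp: vec_eq_iff forall_2)
  then have "v = (v $ 2 / u $ 2) *\<^sub>R u"
    using assms(1) True by (auto simp: vec_eq_iff forall_2 field_simps)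
  then show ?thesis
    using that by blast
next
  case False
  then have "v = (v $ 1 / u $ 1) *\<^sub>R u"
    using assms(1) by (auto simp: vec_eq_iff forall_2 field_simps)
  then show ?thesis
    using that by blast
qed

section \<open>Uniqueness of the alternating pair\<close>

text \<open>The middle point is always on the upper line, with value \<open>c\<close>; the opposite
  pattern is the case of \<open>-u\<close>, \<open>-c\<close>, \<open>-b\<close>. Equality of
  \<open>b\<close> and \<open>c\<close> is allowed.\<close>

definition alternates :: "(real \<Rightarrow> 'a::real_inner) \<Rightarrow> 'a \<Rightarrow> real \<Rightarrow> real \<Rightarrow> bool" where
  "alternates g u b c \<longleftrightarrow> u \<noteq> 0 \<and> (\<forall>x\<in>{0..1}. b \<le> u \<bullet> g x \<and> u \<bullet> g x \<le> c) \<and>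
     (\<exists>r s t. 0 \<le> r \<and> r < s \<and> s < t \<and> t \<le> 1 \<and> u \<bullet> g r = b \<and> u \<bullet> g s = c \<and> u \<bullet> g t = b)"

text \<open>Uniqueness when the normals are the coordinate axes. Every contradiction comes from two
  subarcs over disjoint parameter intervals that are forced to cross.\<close>

lemma alternates_coordinates_not_inj:
  fixes f :: "real \<Rightarrow> real^2"
  assumes "path f" and box: "path_image f \<subseteq> cbox a b"
    and rst: "0 \<le> r" "r < s" "s < t" "t \<le> 1"
    and pqw: "0 \<le> p" "p < q" "q < w" "w \<le> 1"
    and f1: "f r $ 1 = a $ 1" "f s $ 1 = b $ 1" "f t $ 1 = a $ 1"
    and f2: "f p $ 2 = a $ 2" "f q $ 2 = b $ 2" "f w $ 2 = a $ 2"
  shows "\<not> inj_on f {0..1}"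
proof
  assume inj: "inj_on f {0..1}"
  have sub: "path (subpath x y f)" "path_image (subpath x y f) \<subseteq> cbox a b"
    if "x \<in> {0..1}" "y \<in> {0..1}" for x y
    using that assms(1) box path_image_subpath_subset[of x y f] by (auto simp: path_subpath)
  \<comment> \<open>Subpaths may run backwards, hence the minima and maxima.\<close>
  have meet: False
    if z: "z \<in> path_image (subpath x y f)" "z \<in> path_image (subpath x' y' f)"
      and par: "{x, y, x', y'} \<subseteq> {0..1}" and less: "max x y < min x' y'" for x y x' y' z
  proof -
    have param: "\<exists>i. z = f i \<and> min x y \<le> i \<and> i \<le> max x y"
      if "z \<in> path_image (subpath x y f)" for x y
      using that by (auto simp: path_image_subpath split: if_splits)
    obtain i j where ij: "z = f i" "z = f j" "min x y \<le> i" "i \<le> max x y" "min x' y' \<le> j" "j \<le> max x' y'"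
      using param[OF z(1)] param[OF z(2)] by blast
    moreover have "i \<in> {0..1}" "j \<in> {0..1}"
      using ij par by auto
    ultimately have "i = j"
      using inj by (auto simp: inj_on_def)
    then show False
      using ij less by linarith
  qed
  have I: "r \<in> {0..1}" "s \<in> {0..1}" "t \<in> {0..1}" "p \<in> {0..1}" "q \<in> {0..1}" "w \<in> {0..1}"
    using rst pqw by auto
  have "q \<le> s"
  proof (rule ccontr)
    assume "\<not> q \<le> s"
    \<comment> \<open>The part over \<open>[q,w]\<close> is run backwards so that it goes from
      bottom to top, as \<open>fashoda\<close> expects.\<close>
    moreover obtain z where "z \<in> path_image (subpath r s f)" "z \<in> path_image (subpath w q f)"
      by (rule fashoda[of "subpath r s f" "subpath w q f" a b]) (simp_all only: sub I f1 f2 pathstart_subpath pathfinish_subpath)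
    ultimately show False
      using meet[of z r s w q] rst pqw by auto
  qed
  moreover have "s \<le> q"
  proof (rule ccontr)
    assume "\<not> s \<le> q"
    moreover obtain z where "z \<in> path_image (subpath t s f)" "z \<in> path_image (subpath p q f)"
      by (rule fashoda[of "subpath t s f" "subpath p q f" a b]) (simp_all only: sub I f1 f2 pathstart_subpath pathfinish_subpath)
    ultimately show False
      using meet[of z p q t s] rst pqw by auto
  qed
  ultimately have "q = s"
    by simp
  \<comment> \<open>Both points are on the bottom side, so they differ in the first coordinate; the
    smaller one is farther from the corner \<open>f s\<close>.\<close>
  have "f p \<noteq> f w"
    using inj_onD[OF inj _ I(4,6)] pqw by auto
  then consider "f p $ 1 < f w $ 1" | "f w $ 1 < f p $ 1"
    using f2 by (auto simp: vec_eq_iff forall_2 neq_iff)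
  then show False
  proof cases
    case 1
    \<comment> \<open>The subarc between \<open>t\<close> and \<open>w\<close> joins the left side
      to a bottom point right of \<open>f p\<close>, and so separates \<open>f p\<close> from
      \<open>f s\<close>.\<close>
    obtain z where "z \<in> path_image (subpath p s f)" "z \<in> path_image (subpath t w f)"
      by (rule fashoda_corner[of "subpath p s f" "subpath t w f" a b])
        (use 1 f2 \<open>q = s\<close> in \<open>simp_all only: sub I f1 pathstart_subpath pathfinish_subpath\<close>)
    then show False
      using meet[of z p s t w] rst pqw \<open>q = s\<close> by auto
  next
    case 2
    \<comment> \<open>The same with time reversed: the subarc between \<open>r\<close> and
      \<open>p\<close> separates \<open>f w\<close> from \<open>f s\<close>.\<close>
    obtain z where "z \<in> path_image (subpath w s f)" "z \<in> path_image (subpath r p f)"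
      by (rule fashoda_corner[of "subpath w s f" "subpath r p f" a b])
        (use 2 f2 \<open>q = s\<close> in \<open>simp_all only: sub I f1 pathstart_subpath pathfinish_subpath\<close>)
    then show False
      using meet[of z r p w s] rst pqw \<open>q = s\<close> by auto
  qed
qed

lemma alternates_unique:
  fixes g :: "real \<Rightarrow> real^2"
  assumes "path g" "inj_on g {0..1}" and u: "alternates g u b c" and v: "alternates g v b' c'"
  shows "{{x. u \<bullet> x = b}, {x. u \<bullet> x = c}} = {{x. v \<bullet> x = b'}, {x. v \<bullet> x = c'}}"
proof -
  obtain r s t where rst: "0 \<le> r" "r < s" "s < t" "t \<le> 1" "u \<bullet> g r = b" "u \<bullet> g s = c" "u \<bullet> g t = b"
    and ub: "\<And>x. 0 \<le> x \<Longrightarrow> x \<le> 1 \<Longrightarrow> b \<le> u \<bullet> g x \<and> u \<bullet> g x \<le> c" and "u \<noteq> 0"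
    using u by (auto simp: alternates_def)
  obtain p q w where pqw: "0 \<le> p" "p < q" "q < w" "w \<le> 1" "v \<bullet> g p = b'" "v \<bullet> g q = c'" "v \<bullet> g w = b'"
    and vb: "\<And>x. 0 \<le> x \<Longrightarrow> x \<le> 1 \<Longrightarrow> b' \<le> v \<bullet> g x \<and> v \<bullet> g x \<le> c'" and "v \<noteq> 0"
    using v by (auto simp: alternates_def)
  have det: "u $ 1 * v $ 2 = u $ 2 * v $ 1"
  proof (rule ccontr)
    assume det: "u $ 1 * v $ 2 \<noteq> u $ 2 * v $ 1"
    define f where "f = (\<lambda>x. \<chi> i. if i = 1 then u \<bullet> g x else v \<bullet> g x :: real^2)"
    have f [simp]: "f x $ 1 = u \<bullet> g x" "f x $ 2 = v \<bullet> g x" for x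
      by (auto simp: f_def)
    have "continuous_on {0..1} (\<lambda>x. if i = 1 then u \<bullet> g x else v \<bullet> g x)" for i :: 2
      using assms(1) by (cases "i = 1") (auto simp: path_def intro!: continuous_intros)
    then have "path f"
      unfolding path_def f_def by (intro continuous_on_vec_lambda)
    moreover have "path_image f \<subseteq> cbox (vector [b, b']) (vector [c, c'])"
      using ub vb by (auto simp: path_image_def mem_box_cart forall_2)
    ultimately have "\<not> inj_on f {0..1}"
      using rst pqw by (intro alternates_coordinates_not_inj[of f _ _ r s t p q w]) auto
    moreover have "inj_on f {0..1}"
    proof (rule inj_onI)
      fix x y assume xy: "x \<in> {0..1}" "y \<in> {0..1}" "f x = f y"
      then have "g x = g y"
        using f by (intro inner_pair_inj[OF det]) metis+
      then show "x = y"
        using assms(2) xy by (auto simp: inj_on_def)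
    qed
    ultimately show False
      by simp
  qed
  then obtain k where k: "v = k *\<^sub>R u"
    using \<open>u \<noteq> 0\<close> parallel_vec2 by blast
  then have "k \<noteq> 0"
    using \<open>v \<noteq> 0\<close> by auto
  \<comment> \<open>On the arc \<open>u\<close> attains \<open>b\<close> and \<open>c\<close>, and
    \<open>v\<close> attains \<open>b'\<close> and \<open>c'\<close>, so multiplication by
    \<open>k\<close> maps \<open>[b,c]\<close> onto \<open>[b',c']\<close>; the sign of
    \<open>k\<close> decides which ends correspond.\<close>
  have lo: "b' \<le> k * b" "b' \<le> k * c" and hi: "k * b \<le> c'" "k * c \<le> c'"
    using vb[of r] vb[of s] rst by (auto simp: k)
  have pq: "b \<le> u \<bullet> g p" "u \<bullet> g p \<le> c" "b \<le> u \<bullet> g q" "u \<bullet> g q \<le> c" "k * (u \<bullet> g p) = b'" "k * (u \<bullet> g q) = c'"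
    using ub[of p] ub[of q] pqw by (auto simp: k)
  show ?thesis
  proof (cases "k > 0")
    case True
    then have "b' = k * b" "c' = k * c"
      using lo hi pq mult_left_mono[of b "u \<bullet> g p" k] mult_left_mono[of "u \<bullet> g q" c k] by auto
    then show ?thesis
      using \<open>k \<noteq> 0\<close> by (simp add: k)
  next
    case False
    then have "b' = k * c" "c' = k * b"
      using lo hi pq mult_left_mono_neg[of "u \<bullet> g p" c k] mult_left_mono_neg[of b "u \<bullet> g q" k] by auto
    then show ?thesis
      using \<open>k \<noteq> 0\<close> by (simp add: k insert_commute)
  qed
qed

section \<open>Existence of an alternating direction\<close>

lemma alternates_exists:
  fixes g :: "real \<Rightarrow> 'a::euclidean_space"
  assumes "path g" and dim: "2 \<le> DIM('a)"
  obtains u b c where "alternates g u b c"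
proof -
  let ?I = "{0..1::real}" and ?S = "sphere (0::'a) 1"
  \<comment> \<open>\<open>A\<close> consists of the unit normals for which some maximum occurs no
    later than some minimum. Keeping the two parameters in \<open>T\<close> makes the conditions
    closed, and compactness passes to the projection.\<close>
  define T where "T = {(u, s, t). u \<in> ?S \<and> s \<in> ?I \<and> t \<in> ?I \<and> s \<le> t \<and>
     (\<forall>x\<in>?I. u \<bullet> g x \<le> u \<bullet> g s \<and> u \<bullet> g t \<le> u \<bullet> g x)}"
  define A where "A = fst ` T"
  have g: "continuous_on ?I g"
    using assms(1) by (simp add: path_def)
  have "u \<in> A \<longleftrightarrow> (\<exists>s t. (u, s, t) \<in> T)" for u
    unfolding A_def by force
  then have mem: "u \<in> A \<longleftrightarrow> u \<in> ?S \<and> (\<exists>s\<in>?I. \<exists>t\<in>?I. s \<le> t \<and>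
     (\<forall>x\<in>?I. u \<bullet> g x \<le> u \<bullet> g s \<and> u \<bullet> g t \<le> u \<bullet> g x))" for u
    unfolding T_def mem_Collect_eq case_prod_conv by blast
  have "closed T"
  proof -
    let ?D = "?S \<times> ?I \<times> ?I"
    have D: "closed ?D"
      by (intro closed_Times) auto
    have cont: "continuous_on ?D (\<lambda>z. g (fst (snd z)))" "continuous_on ?D (\<lambda>z. g (snd (snd z)))"
      by (rule continuous_on_compose2[OF g]; force intro: continuous_intros)+
    have le: "closed {z \<in> ?D. \<phi> z \<le> \<psi> z}"
      if "continuous_on ?D \<phi>" "continuous_on ?D \<psi>" for \<phi> \<psi> :: "'a \<times> real \<times> real \<Rightarrow> real"
      using that D by (intro continuous_on_closed_Collect_le)
    have "T = {z \<in> ?D. fst (snd z) \<le> snd (snd z)} \<inter>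
      (\<Inter>x\<in>?I. {z \<in> ?D. fst z \<bullet> g x \<le> fst z \<bullet> g (fst (snd z))}
              \<inter> {z \<in> ?D. fst z \<bullet> g (snd (snd z)) \<le> fst z \<bullet> g x})"
      unfolding T_def case_prod_beta mem_Times_iff INT_iff Int_iff set_eq_iff mem_Collect_eq by blast
    also have "closed \<dots>"
      by (intro closed_Int closed_INT ballI le continuous_intros cont)
    finally show ?thesis .
  qed
  moreover have "T \<subseteq> ?S \<times> ?I \<times> ?I"
    by (auto simp: T_def)
  ultimately have "compact T"
    by (metis closed_Int_compact compact_Icc compact_Times compact_sphere inf.absorb1)
  then have "closed A"
    unfolding A_def by (intro compact_imp_closed compact_continuous_image continuous_intros)
  then have "closed (uminus ` A)"
    by (simp add: closed_negations)
  have cover: "u \<in> A \<union> uminus ` A" if "u \<in> ?S" for u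
  proof -
    have "continuous_on ?I (\<lambda>x. u \<bullet> g x)"
      by (intro continuous_intros g)
    then obtain s t where st: "s \<in> ?I" "t \<in> ?I" "\<forall>x\<in>?I. u \<bullet> g x \<le> u \<bullet> g s" "\<forall>x\<in>?I. u \<bullet> g t \<le> u \<bullet> g x"
      using continuous_attains_sup[of ?I "\<lambda>x. u \<bullet> g x"] continuous_attains_inf[of ?I "\<lambda>x. u \<bullet> g x"] by auto
    show ?thesis
    proof (cases "s \<le> t")
      case True
      then have "u \<in> A"
        unfolding mem using st \<open>u \<in> ?S\<close> by blast
      then show ?thesis
        by simp
    next
      case False
      \<comment> \<open>For \<open>-u\<close> maximum and minimum exchange roles, so
        \<open>t < s\<close> is the required order.\<close>
      have "- u \<in> A"
        unfolding mem using st \<open>u \<in> ?S\<close> False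
        by (intro conjI bexI[of _ t] bexI[of _ s]) auto
      then show ?thesis
        by (metis UnI2 image_eqI minus_minus)
    qed
  qed
  have "A \<inter> uminus ` A \<inter> ?S \<noteq> {}"
  proof
    assume empty: "A \<inter> uminus ` A \<inter> ?S = {}"
    obtain e :: 'a where "e \<in> ?S"
      using SOME_Basis by (auto intro!: that[of "SOME b. b \<in> Basis"])
    \<comment> \<open>Either alternative puts a point of the sphere into each of the two closed
      sets.\<close>
    then have "e \<in> A \<or> - e \<in> A"
      using cover by force
    then have "A \<inter> ?S \<noteq> {}" "uminus ` A \<inter> ?S \<noteq> {}"
      using \<open>e \<in> ?S\<close> by force+
    then show False
      using connected_sphere[OF dim, of 0 1] \<open>closed A\<close> \<open>closed (uminus ` A)\<close> cover empty
      unfolding connected_closed by blast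
  qed
  then obtain u where u: "u \<in> A" "- u \<in> A" "u \<in> ?S"
    by force
  obtain s t where st: "s \<in> ?I" "t \<in> ?I" "s \<le> t" "\<And>x. x \<in> ?I \<Longrightarrow> u \<bullet> g x \<le> u \<bullet> g s"
    "\<And>x. x \<in> ?I \<Longrightarrow> u \<bullet> g t \<le> u \<bullet> g x"
    using u(1) unfolding mem by blast
  obtain s' t' where st': "s' \<in> ?I" "t' \<in> ?I" "s' \<le> t'" "\<And>x. x \<in> ?I \<Longrightarrow> - u \<bullet> g x \<le> - u \<bullet> g s'"
    "\<And>x. x \<in> ?I \<Longrightarrow> - u \<bullet> g t' \<le> - u \<bullet> g x"
    using u(2) unfolding mem by blast
  define b c where "b = u \<bullet> g t" and "c = u \<bullet> g s"
  \<comment> \<open>The maximum is attained at \<open>s\<close> and \<open>t'\<close>, the minimum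
    at \<open>t\<close> and \<open>s'\<close>.\<close>
  have eq: "u \<bullet> g t' = c" "u \<bullet> g s' = b"
    using st(4)[OF st'(2)] st'(5)[OF st(1)] st(5)[OF st'(1)] st'(4)[OF st(2)]
    by (auto simp: b_def c_def)
  have bnd: "\<forall>x\<in>?I. b \<le> u \<bullet> g x \<and> u \<bullet> g x \<le> c"
    using st by (auto simp: b_def c_def)
  have "u \<noteq> 0"
    using u(3) by auto
  show thesis
  proof (cases "b = c")
    case True
    then have "u \<bullet> g x = b" if "x \<in> ?I" for x
      using bnd that by force
    \<comment> \<open>A functional that is constant on the arc alternates at any three
      parameters.\<close>
    then have "alternates g u b b"
      unfolding alternates_def using \<open>u \<noteq> 0\<close>
      by (intro conjI exI[of _ 0] exI[of _ "1/2"] exI[of _ 1]) auto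
    then show ?thesis
      using that by blast
  next
    case False
    then have neq: "s < t" "s' < t'" "t \<noteq> t'"
      using st(3) st'(3) eq by (auto simp: b_def c_def order_less_le)
    show ?thesis
    \<comment> \<open>If \<open>t < t'\<close>, the order \<open>s < t < t'\<close> reads maximum,
      minimum, maximum, so \<open>-u\<close> alternates; otherwise \<open>s' < t' < t\<close> reads
      minimum, maximum, minimum.\<close>
    proof (cases "t < t'")
      case True
      have "alternates g (- u) (- c) (- b)"
        unfolding alternates_def using \<open>u \<noteq> 0\<close> bnd eq neq True st st'
        by (intro conjI exI[of _ s] exI[of _ t] exI[of _ t']) (auto simp: b_def c_def)
      then show ?thesis
        using that by blast
    next
      case False
      have "alternates g u b c"
        unfolding alternates_def using \<open>u \<noteq> 0\<close> bnd eq neq False st st'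
        by (intro conjI exI[of _ s'] exI[of _ t'] exI[of _ t]) (auto simp: b_def c_def)
      then show ?thesis
        using that by blast
    qed
  qed
qed

section \<open>Alternation in terms of support lines\<close>

text \<open>Negating the normal swaps the upper and the lower line, so both patterns on the left
  reduce to the one in \<open>alternates\<close>; \<open>L\<close> is unordered and does not
  change.\<close>

lemma alternating_support_lines_iff:
  fixes g :: "real \<Rightarrow> real^2"
  shows "(\<exists>l l'. L = {l, l'} \<and> parallel_support_lines g l l' \<and>
           (\<exists>r\<in>{0..1}. \<exists>s\<in>{0..1}. \<exists>t\<in>{0..1}. r < s \<and> s < t \<and>
              (g s \<in> l \<and> g r \<in> l' \<and> g t \<in> l' \<or>
               g s \<in> l' \<and> g r \<in> l \<and> g t \<in> l))) \<longleftrightarrow>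
         (\<exists>u b c. alternates g u b c \<and> L = {{x. u \<bullet> x = b}, {x. u \<bullet> x = c}})"
    (is "?lhs \<longleftrightarrow> ?rhs")
proof
  assume ?lhs
  then obtain l l' r s t where L: "L = {l, l'}" and par: "parallel_support_lines g l l'"
    and rst: "r \<in> {0..1}" "s \<in> {0..1}" "t \<in> {0..1}" "r < s" "s < t"
    and alt: "g s \<in> l \<and> g r \<in> l' \<and> g t \<in> l' \<or> g s \<in> l' \<and> g r \<in> l \<and> g t \<in> l"
    by blast
  obtain a b c where a: "a \<noteq> 0" "l = {x. a \<bullet> x = b}" "l' = {x. a \<bullet> x = c}"
    and bnd: "\<And>x. x \<in> {0..1} \<Longrightarrow> b \<le> a \<bullet> g x \<and> a \<bullet> g x \<le> c"
    using par unfolding parallel_support_lines_def path_image_def by blast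
  from alt show ?rhs
  proof
    assume h: "g s \<in> l' \<and> g r \<in> l \<and> g t \<in> l"
    have "alternates g a b c"
      unfolding alternates_def using a bnd rst h
      by (intro conjI exI[of _ r] exI[of _ s] exI[of _ t]) auto
    then show ?thesis
      using L a by blast
  next
    assume h: "g s \<in> l \<and> g r \<in> l' \<and> g t \<in> l'"
    have "alternates g (- a) (- c) (- b)"
      unfolding alternates_def using a bnd rst h
      by (intro conjI exI[of _ r] exI[of _ s] exI[of _ t]) auto
    moreover have "L = {{x. - a \<bullet> x = - c}, {x. - a \<bullet> x = - b}}"
      using L a by auto
    ultimately show ?thesis
      by blast
  qed
next
  assume ?rhs
  then obtain u b c r s t where L: "L = {{x. u \<bullet> x = b}, {x. u \<bullet> x = c}}"
    and "u \<noteq> 0" and bnd: "\<And>x. x \<in> {0..1} \<Longrightarrow> b \<le> u \<bullet> g x \<and> u \<bullet> g x \<le> c"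
    and rst: "0 \<le> r" "r < s" "s < t" "t \<le> 1" "u \<bullet> g r = b" "u \<bullet> g s = c" "u \<bullet> g t = b"
    unfolding alternates_def by blast
  let ?l = "{x. u \<bullet> x = b}" and ?l' = "{x. u \<bullet> x = c}"
  have "support_line g ?l'"
    unfolding support_line_def path_image_def
    using \<open>u \<noteq> 0\<close> bnd rst by (intro conjI exI[of _ u] exI[of _ c]) auto
  \<comment> \<open>The lower line needs the opposite normal, since \<open>support_line\<close> only
    has the upper inequality.\<close>
  moreover have "support_line g ?l"
    unfolding support_line_def path_image_def
    using \<open>u \<noteq> 0\<close> bnd rst by (intro conjI exI[of _ "- u"] exI[of _ "- b"]) auto
  moreover have "path_image g \<subseteq> {x. b \<le> u \<bullet> x \<and> u \<bullet> x \<le> c}"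
    using bnd by (auto simp: path_image_def)
  ultimately have "parallel_support_lines g ?l ?l'"
    unfolding parallel_support_lines_def using \<open>u \<noteq> 0\<close> by blast
  moreover have "\<exists>r\<in>{0..1}. \<exists>s\<in>{0..1}. \<exists>t\<in>{0..1}. r < s \<and> s < t \<and>
      (g s \<in> ?l \<and> g r \<in> ?l' \<and> g t \<in> ?l' \<or> g s \<in> ?l' \<and> g r \<in> ?l \<and> g t \<in> ?l)"
    using rst by (intro bexI[of _ r] bexI[of _ s] bexI[of _ t]) auto
  ultimately show ?lhs
    using L by blast
qed

theorem mainTheorem2:
  fixes g :: "real \<Rightarrow> real^2"
  assumes "rectifiable g"
    and "inj_on g {0..1}"
    and "g 0 \<noteq> g 1"
    and "thickness g > 0"
  shows "\<exists>!L. \<exists>l l'. L = {l, l'} \<and> parallel_support_lines g l l' \<and>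
           (\<exists>r\<in>{0..1}. \<exists>s\<in>{0..1}. \<exists>t\<in>{0..1}. r < s \<and> s < t \<and>
              (g s \<in> l \<and> g r \<in> l' \<and> g t \<in> l' \<or>
               g s \<in> l' \<and> g r \<in> l \<and> g t \<in> l))"
proof -
  have g: "path g"
    using assms(1) by (simp add: rectifiable_def)
  obtain u b c where u: "alternates g u b c"
    using alternates_exists[OF g] by auto
  show ?thesis
    unfolding alternating_support_lines_iff
  proof (rule ex1I)
    show "\<exists>v b' c'. alternates g v b' c' \<and> {{x. u \<bullet> x = b}, {x. u \<bullet> x = c}} = {{x. v \<bullet> x = b'}, {x. v \<bullet> x = c'}}"
      using u by blast
  next
    fix L
    assume "\<exists>v b' c'. alternates g v b' c' \<and> L = {{x. v \<bullet> x = b'}, {x. v \<bullet> x = c'}}"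
    then obtain v b' c' where "alternates g v b' c'" "L = {{x. v \<bullet> x = b'}, {x. v \<bullet> x = c'}}"
      by blast
    then show "L = {{x. u \<bullet> x = b}, {x. u \<bullet> x = c}}"
      using alternates_unique[OF g assms(2) _ u] by simp
  qed
qed

end
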